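(* Let $n\ge 1$, let $A\in\mathcal{M}_n(\mathbb{T})$ be an $n\times n$ tropical matrix, and let $\overline{n}=\operatorname{lcm}(1,\dots,n)$. If $\operatorname{rk}_{\mathrm{tr}}(A^{\overline{n}})<n$, then $\operatorname{rk}_{\mathrm{fc}}(A^{t\overline{n}})<n$ for every integer $t\ge 3n-2$, where $\operatorname{rk}_{\mathrm{fc}}$ denotes the factor rank and $\operatorname{rk}_{\mathrm{tr}}$ the tropical rank.
   Context: $\mathbb{T}=\mathbb{R}\cup\{-\infty\}$ is the max-plus (tropical) semiring: addition is $\max$, multiplication is the usual $+$, the zero element is $-\infty$. $\mathcal{M}_n(\mathbb{T})$ is the monoid of all $n\times n$ matrices over $\mathbb{T}$ with the induced (max-plus) multiplication, and powers of matrices are taken in it; $\mathcal{M}_{m,k}(\mathbb{T})$ is the set of $m\times k$ tropical matrices. For a square $k\times k$ tropical matrix $A$, the weight of a permutation $\pi\in S_k$ is $\sum_i A_{i,\pi(i)}$ and the permanent $\operatorname{per}(A)$ is the maximum of the weights of all $\pi\in S_k$. $A$ is nonsingular if there is a unique permutation whose weight equals $\operatorname{per}(A)$, and singular otherwise. The tropical rank $\operatorname{rk}_{\mathrm{tr}}(A)$ of a tropical matrix $A$ is the largest $k$ for which $A$ has a $k\times k$ nonsingular submatrix. The factor rank $\operatorname{rk}_{\mathrm{fc}}(A)$ of an $n\times n$ tropical matrix $A$ is the smallest $k$ for which $A=BC$ (max-plus product) with $B\in\mathcal{M}_{n,k}(\mathbb{T})$ and $C\in\mathcal{M}_{k,n}(\mathbb{T})$;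 equivalently, the minimal number of rank-one matrices whose entrywise maximum is $A$. *)

theory Defs
  imports
    "HOL-Combinatorics.Permutations"
    "Jordan_Normal_Form.Matrix"
    "Jordan_Normal_Form.DL_Submatrix"
begin

text \<open>
  The max-plus semiring is made an instance of \<^class>\<open>comm_semiring_1\<close>, so that the library's
  matrix product and powers over it are the max-plus ones. Pitfall: \<open>0 :: trop\<close> is
  \<open>NegInf\<close> and \<open>1 :: trop\<close> is \<open>Fin 0\<close>; a product \<open>\<Prod>\<close> of tropical numbers is an
  ordinary sum of reals (with \<open>NegInf\<close> absorbing).
\<close>

datatype trop = NegInf | Fin real

instantiation trop :: linorder
begin

fun less_eq_trop :: "trop \<Rightarrow> trop \<Rightarrow> bool" where
  "NegInf \<le> y \<longleftrightarrow> True"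
| "Fin a \<le> NegInf \<longleftrightarrow> False"
| "Fin a \<le> Fin b \<longleftrightarrow> a \<le> b"

definition less_trop :: "trop \<Rightarrow> trop \<Rightarrow> bool" where
  "x < y \<longleftrightarrow> x \<le> y \<and> \<not> y \<le> (x :: trop)"

instance
proof
  fix x y z :: trop
  show "x < y \<longleftrightarrow> x \<le> y \<and> \<not> y \<le> x" by (rule less_trop_def)
  show "x \<le> x" by (cases x) auto
  show "x \<le> y \<Longrightarrow> y \<le> z \<Longrightarrow> x \<le> z" by (cases x; cases y; cases z) auto
  show "x \<le> y \<Longrightarrow> y \<le> x \<Longrightarrow> x = y" by (cases x; cases y) auto
  show "x \<le> y \<or> y \<le> x" by (cases x; cases y) auto
qed

end

instantiation trop :: comm_semiring_1
begin

definition zero_trop :: trop where "0 = NegInf"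

definition one_trop :: trop where "1 = Fin 0"

definition plus_trop :: "trop \<Rightarrow> trop \<Rightarrow> trop" where
  "x + y = max x (y :: trop)"

fun times_trop :: "trop \<Rightarrow> trop \<Rightarrow> trop" where
  "NegInf * y = NegInf"
| "Fin a * NegInf = NegInf"
| "Fin a * Fin b = Fin (a + b)"

instance
proof
  fix a b c :: trop
  show "a + b + c = a + (b + c)" by (simp add: plus_trop_def max.assoc)
  show "a + b = b + a" by (simp add: plus_trop_def max.commute)
  show "0 + a = a" by (cases a) (simp_all add: plus_trop_def zero_trop_def max_def)
  show "a * b * c = a * (b * c)" by (cases a; cases b; cases c) simp_all
  show "a * b = b * a" by (cases a; cases b) simp_all
  show "1 * a = a" by (cases a) (simp_all add: one_trop_def)
  show "(a + b) * c = a * c + b * c"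
    by (cases a; cases b; cases c) (auto simp: plus_trop_def max_def)
  show "0 * a = 0" by (simp add: zero_trop_def)
  show "a * 0 = 0" by (cases a) (simp_all add: zero_trop_def)
  show "(0 :: trop) \<noteq> 1" by (simp add: zero_trop_def one_trop_def)
qed

end

definition perm_weight :: "trop mat \<Rightarrow> (nat \<Rightarrow> nat) \<Rightarrow> trop" where
  "perm_weight A p = (\<Prod>i = 0..<dim_row A. A $$ (i, p i))"

definition trop_per :: "trop mat \<Rightarrow> trop" where
  "trop_per A = Max (perm_weight A ` {p. p permutes {0..<dim_row A}})"

text \<open>
  The permanent is not required to be finite. For \<open>k \<ge> 2\<close> a matrix with permanent \<open>NegInf\<close>
  is singular anyway, as every permutation attains it; the \<open>1 \<times> 1\<close> matrix with entry
  \<open>NegInf\<close> is nonsingular.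
\<close>

definition trop_nonsingular :: "trop mat \<Rightarrow> bool" where
  "trop_nonsingular A \<longleftrightarrow>
     square_mat A \<and> (\<exists>!p. p permutes {0..<dim_row A} \<and> perm_weight A p = trop_per A)"

text \<open>
  The set below contains \<open>k = 0\<close> (the empty matrix is nonsingular) and is bounded by both
  dimensions of \<open>A\<close>.
\<close>

definition tropical_rank :: "trop mat \<Rightarrow> nat" where
  "tropical_rank A = Max {k. \<exists>I J. I \<subseteq> {0..<dim_row A} \<and> J \<subseteq> {0..<dim_col A} \<and>
     card I = k \<and> card J = k \<and> trop_nonsingular (submatrix A I J)}"

text \<open>
  \<open>k = 0\<close> is allowed: a product of an \<open>n \<times> 0\<close> and a \<open>0 \<times> n\<close> matrix has all entries
  \<open>NegInf\<close>, being the entrywise maximum of no rank-one matrices.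
\<close>

definition factor_rank :: "trop mat \<Rightarrow> nat" where
  "factor_rank A = (LEAST k. \<exists>B C. B \<in> carrier_mat (dim_row A) k \<and>
     C \<in> carrier_mat k (dim_col A) \<and> A = B * C)"

lemma factor_rank_attained:
  "\<exists>B C. B \<in> carrier_mat (dim_row A) (factor_rank A) \<and>
     C \<in> carrier_mat (factor_rank A) (dim_col A) \<and> A = B * C"
  unfolding factor_rank_def
proof (rule LeastI)
  show "\<exists>B C. B \<in> carrier_mat (dim_row A) (dim_col A) \<and>
     C \<in> carrier_mat (dim_col A) (dim_col A) \<and> A = B * C"
    by (intro exI[of _ A] exI[of _ "1\<^sub>m (dim_col A)"]) auto
qed

lemma tropical_rank_attained:
  "\<exists>I J. I \<subseteq> {0..<dim_row A} \<and> J \<subseteq> {0..<dim_col A} \<and>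
     card I = tropical_rank A \<and> card J = tropical_rank A \<and> trop_nonsingular (submatrix A I J)"
proof -
  let ?S = "{k. \<exists>I J. I \<subseteq> {0..<dim_row A} \<and> J \<subseteq> {0..<dim_col A} \<and>
     card I = k \<and> card J = k \<and> trop_nonsingular (submatrix A I J)}"
  have "?S \<subseteq> {..dim_row A}"
  proof
    fix k assume "k \<in> ?S"
    then obtain I where "I \<subseteq> {0..<dim_row A}" "card I = k" by blast
    then show "k \<in> {..dim_row A}" using card_mono[of "{0..<dim_row A}" I] by simp
  qed
  then have fin: "finite ?S" using finite_subset by blast
  have "trop_nonsingular (submatrix A {} {})"
    by (simp add: trop_nonsingular_def trop_per_def perm_weight_def submatrix_def)
  then have "0 \<in> ?S" by (auto intro!: exI[of _ "{}"])
  then have "Max ?S \<in> ?S" using Max_in[OF fin] by blast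
  then show ?thesis unfolding tropical_rank_def by simp
qed

end

(*
Write N for lcm(1..n) and read the entry (x, y) of A^p as the greatest weight of a walk of length p.

If some diagonal entry of A^N is NegInf, that vertex i lies on no cycle. The rows of a power of A that
belong to i and to the set R of vertices reachable from i are supported on the columns in R, so the
columns in R and the rows outside R and i cover the matrix with n - 1 rank-one terms.

Otherwise let d(v) be the weight of the loop at v in A^N. Singularity yields a permutation at least as
heavy as the diagonal, hence a cycle of A^N of length l between 2 and n at least as heavy as the loops
at its vertices; let k be the vertex of this cycle with the smallest loop. Among the vertices on optimal
walks from x to y of length t N, take one with the largest d. No closed piece of an optimal walk has
larger mean, so by the pigeonhole principle its closed pieces can be traded for loops: some optimal walk
is, in steps of A^N, at most n - 1 steps to a vertex z, then loops at z, then at most n - 1 steps to y.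
For t >= 3n - 2 there are at least n loops, so at step n the walk is at z, and if z = k, then l of the
loops can be replaced by the cycle so that step n is elsewhere on it. Hence the vertex k can be left
out of the product A^(n N) A^((t - n) N).
*)

theory Submission
  imports Defs "HOL-Combinatorics.Cycles"
begin

subsection \<open>Tropical sums and products\<close>

lemma zero_le_trop [simp]: "0 \<le> (x :: trop)"
  by (simp add: zero_trop_def)

lemma trop_le_zero_iff [simp]: "x \<le> 0 \<longleftrightarrow> x = (0 :: trop)"
  by (simp add: order.eq_iff)

instance trop :: ordered_comm_semiring
proof
  fix a b c :: trop
  show "c + a \<le> c + b" if "a \<le> b"
    using that by (simp add: plus_trop_def max.coboundedI2)
  show "c * a \<le> c * b" if "a \<le> b"
    using that by (cases a; cases b; cases c) auto
qed

lemma Fin_neq_zero [simp]: "Fin a \<noteq> 0"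
  by (simp add: zero_trop_def)

lemma Fin_0_eq_1: "Fin 0 = 1"
  by (simp add: one_trop_def)

lemma trop_neq_zeroE: "x \<noteq> (0 :: trop) \<Longrightarrow> (\<And>a. x = Fin a \<Longrightarrow> thesis) \<Longrightarrow> thesis"
  by (cases x) (auto simp: zero_trop_def)

lemma trop_mult_eq_zero_iff [simp]: "x * y = 0 \<longleftrightarrow> x = 0 \<or> y = (0 :: trop)"
  by (cases x; cases y) (auto simp: zero_trop_def)

lemma trop_mult_mono: "a \<le> b \<Longrightarrow> c \<le> d \<Longrightarrow> a * c \<le> b * (d :: trop)"
  by (simp add: mult_mono)

lemma trop_prod_mono: "(\<And>i. i \<in> I \<Longrightarrow> f i \<le> g i) \<Longrightarrow> prod f I \<le> (prod g I :: trop)"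
  by (induction I rule: infinite_finite_induct) (auto intro!: trop_mult_mono)

lemma trop_prod_Fin: "(\<Prod>i\<in>I. Fin (f i)) = Fin (\<Sum>i\<in>I. f i)"
  by (induction I rule: infinite_finite_induct) (auto simp: one_trop_def)

lemma trop_sum_le_iff: "finite I \<Longrightarrow> sum f I \<le> c \<longleftrightarrow> (\<forall>i\<in>I. f i \<le> (c :: trop))"
  by (induction I rule: finite_induct) (auto simp: plus_trop_def)

lemma trop_le_sum: "finite I \<Longrightarrow> i \<in> I \<Longrightarrow> f i \<le> (sum f I :: trop)"
  using trop_sum_le_iff[of I f "sum f I"] by auto

lemma trop_sum_attained: "finite I \<Longrightarrow> sum f I \<noteq> (0 :: trop) \<Longrightarrow> \<exists>i\<in>I. sum f I = f i"
proof (induction I rule: finite_induct)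
  case (insert i I)
  then show ?case
    by (cases "f i \<le> sum f I") (auto simp: plus_trop_def max_def)
qed simp

text \<open>The bijection \<open>h\<close> renumbers the indices other than \<open>k\<close> as
  \<open>0..<n - 1\<close>, which turns the sum into a matrix product of inner dimension
  \<open>n - 1\<close>.\<close>

lemma factor_rank_less:
  fixes b c :: "nat \<Rightarrow> nat \<Rightarrow> trop"
  assumes P: "P \<in> carrier_mat n n" and k: "k < n"
    and eq: "\<And>x y. x < n \<Longrightarrow> y < n \<Longrightarrow> P $$ (x, y) = (\<Sum>j\<in>{0..<n} - {k}. b x j * c j y)"
  shows "factor_rank P < n"
proof -
  have "card ({0..<n} - {k}) = n - 1" using k by simp
  then obtain h where h: "bij_betw h {0..<n - 1} ({0..<n} - {k})"
    using ex_bij_betw_nat_finite[of "{0..<n} - {k}"] by auto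
  define B where "B = mat n (n - 1) (\<lambda>(x, j). b x (h j))"
  define C where "C = mat (n - 1) n (\<lambda>(j, y). c (h j) y)"
  have "P = B * C"
  proof (rule eq_matI)
    fix x y assume "x < dim_row (B * C)" "y < dim_col (B * C)"
    then have xy: "x < n" "y < n" by (auto simp: B_def C_def)
    then have "(B * C) $$ (x, y) = (\<Sum>j = 0..<n - 1. b x (h j) * c (h j) y)"
      by (simp add: B_def C_def scalar_prod_def)
    also have "\<dots> = (\<Sum>j\<in>{0..<n} - {k}. b x j * c j y)"
      by (rule sum.reindex_bij_betw[OF h])
    finally show "P $$ (x, y) = (B * C) $$ (x, y)" using eq xy by simp
  qed (use P in \<open>auto simp: B_def C_def\<close>)
  then have "factor_rank P \<le> n - 1"
    unfolding factor_rank_def using P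
    by (intro Least_le exI[of _ B] exI[of _ C]) (auto simp: B_def C_def)
  then show ?thesis using k by simp
qed

subsection \<open>Walks of maximal weight\<close>

definition max_weight :: "trop mat \<Rightarrow> nat \<Rightarrow> nat \<Rightarrow> nat \<Rightarrow> trop" where
  "max_weight A p x y = (A ^\<^sub>m p) $$ (x, y)"

lemma max_weight_0: "A \<in> carrier_mat n n \<Longrightarrow> x < n \<Longrightarrow> y < n \<Longrightarrow>
  max_weight A 0 x y = (if x = y then Fin 0 else 0)"
  by (auto simp: max_weight_def one_trop_def)

lemma max_weight_1: "A \<in> carrier_mat n n \<Longrightarrow> x < n \<Longrightarrow> y < n \<Longrightarrow>
  max_weight A (Suc 0) x y = A $$ (x, y)"
  by (auto simp: max_weight_def left_mult_one_mat)

lemma max_weight_add: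
  assumes A: "A \<in> carrier_mat n n" and xy: "x < n" "y < n"
  shows "max_weight A (p + q) x y = (\<Sum>z = 0..<n. max_weight A p x z * max_weight A q z y)"
proof -
  have "A ^\<^sub>m (p + q) = A ^\<^sub>m p * A ^\<^sub>m q"
  proof (induction q)
    case (Suc q)
    then show ?case
      using A assoc_mult_mat[of "A ^\<^sub>m p" n n "A ^\<^sub>m q" n A n] by simp
  qed (use A in \<open>simp add: right_mult_one_mat[of _ n n]\<close>)
  then show ?thesis
    using A xy by (simp add: max_weight_def scalar_prod_def)
qed

lemma max_weight_mult_le:
  assumes "A \<in> carrier_mat n n" "x < n" "z < n" "y < n"
  shows "max_weight A p x z * max_weight A q z y \<le> max_weight A (p + q) x y"
  unfolding max_weight_add[OF assms(1,2,4)]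
  by (rule trop_le_sum[where f = "\<lambda>z. max_weight A p x z * max_weight A q z y"]) (use assms in auto)

lemma max_weight_split:
  assumes "A \<in> carrier_mat n n" "x < n" "y < n" "max_weight A (p + q) x y \<noteq> 0"
  obtains z where "z < n" "max_weight A (p + q) x y = max_weight A p x z * max_weight A q z y"
  using assms(4) trop_sum_attained[of "{0..<n}" "\<lambda>z. max_weight A p x z * max_weight A q z y"]
  unfolding max_weight_add[OF assms(1-3)] by (metis atLeastLessThan_iff finite_atLeastLessThan)

lemma max_weight_loop:
  assumes "A \<in> carrier_mat n n" "v < n" "Fin r \<le> max_weight A p v v"
  shows "Fin (real k * r) \<le> max_weight A (k * p) v v"
proof (induction k)
  case (Suc k)
  have "Fin (real (Suc k) * r) = Fin r * Fin (real k * r)" by (simp add: algebra_simps)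
  also have "\<dots> \<le> max_weight A p v v * max_weight A (k * p) v v"
    by (intro trop_mult_mono assms Suc)
  also have "\<dots> \<le> max_weight A (Suc k * p) v v"
    using max_weight_mult_le[OF assms(1,2,2,2)] by simp
  finally show ?case .
qed (use assms in \<open>simp add: max_weight_0\<close>)

lemma prod_le_max_weight:
  assumes A: "A \<in> carrier_mat n n" and "i \<le> j" "\<And>k. k \<in> {i..j} \<Longrightarrow> f k < n"
  shows "(\<Prod>k = i..<j. A $$ (f k, f (Suc k))) \<le> max_weight A (j - i) (f i) (f j)"
  using assms(2,3)
proof (induction j rule: dec_induct)
  case (step j)
  have "(\<Prod>k = i..<Suc j. A $$ (f k, f (Suc k))) =
    (\<Prod>k = i..<j. A $$ (f k, f (Suc k))) * A $$ (f j, f (Suc j))"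
    using step by simp
  also have "\<dots> \<le> max_weight A (j - i) (f i) (f j) * max_weight A (Suc 0) (f j) (f (Suc j))"
    using step by (intro trop_mult_mono) (auto simp: max_weight_1[OF A])
  also have "\<dots> \<le> max_weight A (j - i + Suc 0) (f i) (f (Suc j))"
    using step by (intro max_weight_mult_le[OF A]) auto
  finally show ?case using step by (simp add: Suc_diff_le)
qed (use A in \<open>simp add: max_weight_0 one_trop_def\<close>)

text \<open>The counterpart of \<open>prod_le_max_weight\<close>: a nonzero optimum is the weight of
  an actual walk \<open>f\<close>, found by splitting off the last step.\<close>

lemma max_weight_attained:
  assumes A: "A \<in> carrier_mat n n" and "x < n" "y < n" "max_weight A p x y \<noteq> 0"
  shows "\<exists>f. f 0 = x \<and> f p = y \<and> (\<forall>k\<le>p. f k < n) \<and>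
    max_weight A p x y = (\<Prod>k = 0..<p. A $$ (f k, f (Suc k)))"
  using assms(3,4)
proof (induction p arbitrary: y)
  case 0
  then show ?case using assms(1,2)
    by (intro exI[of _ "\<lambda>_. x"]) (auto simp: max_weight_0 one_trop_def split: if_splits)
next
  case (Suc p)
  then obtain z where z: "z < n"
    "max_weight A (Suc p) x y = max_weight A p x z * max_weight A (Suc 0) z y"
    using max_weight_split[OF A \<open>x < n\<close>, of y p "Suc 0"] by auto
  then obtain f where f: "f 0 = x" "f p = z" "\<forall>k\<le>p. f k < n"
    "max_weight A p x z = (\<Prod>k = 0..<p. A $$ (f k, f (Suc k)))"
    using Suc.IH[of z] Suc.prems by auto
  let ?g = "f(Suc p := y)"
  have "(\<Prod>k = 0..<p. A $$ (?g k, ?g (Suc k))) = (\<Prod>k = 0..<p. A $$ (f k, f (Suc k)))"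
    by (intro prod.cong) auto
  then show ?case
    using z f Suc.prems by (intro exI[of _ ?g]) (auto simp: max_weight_1[OF A] le_Suc_eq)
qed

text \<open>Pieces of an optimal walk are optimal: replacing each by its \<open>max_weight\<close>
  cannot lose weight, and gluing the optimal pieces gives a walk from \<open>x\<close> to
  \<open>y\<close> again.\<close>

lemma max_weight_attained_split:
  assumes A: "A \<in> carrier_mat n n" and xy: "x < n" "y < n" "max_weight A p x y \<noteq> 0"
  obtains f where "f 0 = x" "f p = y" "\<And>k. k \<le> p \<Longrightarrow> f k < n"
    "max_weight A p x y = (\<Prod>k = 0..<p. A $$ (f k, f (Suc k)))"
    "\<And>i j. i \<le> j \<Longrightarrow> j \<le> p \<Longrightarrow> max_weight A p x y =
      max_weight A i x (f i) * max_weight A (j - i) (f i) (f j) * max_weight A (p - j) (f j) y"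
proof -
  obtain f where f: "f 0 = x" "f p = y" "\<forall>k\<le>p. f k < n"
    and opt: "max_weight A p x y = (\<Prod>k = 0..<p. A $$ (f k, f (Suc k)))"
    using max_weight_attained[OF assms] by blast
  have "max_weight A p x y =
      max_weight A i x (f i) * max_weight A (j - i) (f i) (f j) * max_weight A (p - j) (f j) y"
    (is "_ = ?R") if ij: "i \<le> j" "j \<le> p" for i j
  proof (rule antisym)
    let ?w = "\<lambda>i j. \<Prod>k = i..<j. A $$ (f k, f (Suc k))"
    have "max_weight A p x y = ?w 0 i * ?w i j * ?w j p"
      unfolding opt using ij by (simp add: prod.atLeastLessThan_concat)
    also have "\<dots> \<le> ?R"
      using prod_le_max_weight[OF A, of 0 i f] prod_le_max_weight[OF A, of i j f]
        prod_le_max_weight[OF A, of j p f] ij f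
      by (intro trop_mult_mono) auto
    finally show "max_weight A p x y \<le> ?R" .
    have "?R \<le> max_weight A j x (f j) * max_weight A (p - j) (f j) y"
      using max_weight_mult_le[OF A, of x "f i" "f j" i "j - i"] ij f xy
      by (intro trop_mult_mono) auto
    also have "\<dots> \<le> max_weight A p x y"
      using max_weight_mult_le[OF A, of x "f j" y j "p - j"] ij f xy by auto
    finally show "?R \<le> max_weight A p x y" .
  qed
  with f opt show ?thesis by (intro that[of f]) auto
qed

text \<open>The walk has \<open>n + 1\<close> positions at multiples of \<open>N\<close>, so two of them are the same vertex.\<close>

lemma max_weight_pigeonhole:
  assumes A: "A \<in> carrier_mat n n" and xy: "x < n" "y < n" "max_weight A p x y \<noteq> 0"
    and p: "n * N \<le> p"
  obtains u i j where "u < n" "i < j" "j \<le> n" "max_weight A p x y =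
    max_weight A (i * N) x u * max_weight A ((j - i) * N) u u * max_weight A (p - j * N) u y"
proof -
  obtain f where f: "\<And>k. k \<le> p \<Longrightarrow> f k < n"
    and split: "\<And>i j. i \<le> j \<Longrightarrow> j \<le> p \<Longrightarrow> max_weight A p x y =
      max_weight A i x (f i) * max_weight A (j - i) (f i) (f j) * max_weight A (p - j) (f j) y"
    by (rule max_weight_attained_split[OF A xy]) blast
  have le: "i * N \<le> p" if "i \<le> n" for i
    using that p by (meson le_trans mult_le_mono1)
  have "(\<lambda>i. f (i * N)) ` {0..n} \<subseteq> {0..<n}" using f le by auto
  from card_mono[OF _ this] have "card ((\<lambda>i. f (i * N)) ` {0..n}) \<le> n" by simp
  then have "\<not> inj_on (\<lambda>i. f (i * N)) {0..n}" by (intro pigeonhole) simp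
  then obtain i j where ij: "i < j" "j \<le> n" "f (i * N) = f (j * N)"
    unfolding inj_on_def by (metis atLeastAtMost_iff linorder_neqE_nat)
  then have "i \<le> n" by simp
  have "i * N \<le> j * N" using ij by simp
  then have "max_weight A p x y = max_weight A (i * N) x (f (i * N)) *
      max_weight A ((j - i) * N) (f (i * N)) (f (i * N)) * max_weight A (p - j * N) (f (i * N)) y"
    using split[of "i * N" "j * N"] le[of j] ij by (simp only: diff_mult_distrib)
  then show ?thesis
    by (rule that[OF f[OF le[OF \<open>i \<le> n\<close>]] ij(1,2)])
qed

text \<open>A closed walk of more than \<open>n\<close> steps contains a closed piece of at most
  \<open>n\<close> steps. The piece and the closed walk left at \<open>u\<close> both have mean at
  most \<open>\<mu>\<close>, the former by \<open>short\<close> and the latter by induction.\<close>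

lemma max_weight_closed_le:
  assumes A: "A \<in> carrier_mat n n"
    and short: "\<And>v e. v < n \<Longrightarrow> 1 \<le> e \<Longrightarrow> e \<le> n \<Longrightarrow> max_weight A e v v \<le> Fin (real e * \<mu>)"
  shows "u < n \<Longrightarrow> max_weight A L u u \<le> Fin (real L * \<mu>)"
proof (induction L arbitrary: u rule: less_induct)
  case (less L)
  consider "L = 0" | "1 \<le> L" "L \<le> n" | "max_weight A L u u = 0" | "n < L" "max_weight A L u u \<noteq> 0"
    by linarith
  then show ?case
  proof cases
    case 4
    then have "n * 1 \<le> L" by simp
    then obtain v i j where v: "v < n" "i < j" "j \<le> n" and eq: "max_weight A L u u =
      max_weight A (i * 1) u v * max_weight A ((j - i) * 1) v v * max_weight A (L - j * 1) v u"
      by (rule max_weight_pigeonhole[OF A less.prems less.prems 4(2)]) blast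
    have "max_weight A i u v * max_weight A (L - j) v u \<le> max_weight A (L - (j - i)) u u"
      using max_weight_mult_le[OF A less.prems v(1) less.prems, of i "L - j"] v 4
      by (simp add: add.commute)
    also have "\<dots> \<le> Fin (real (L - (j - i)) * \<mu>)"
      using less.IH[OF _ less.prems, of "L - (j - i)"] v 4 by auto
    finally have "max_weight A (j - i) v v * (max_weight A i u v * max_weight A (L - j) v u)
        \<le> Fin (real (j - i) * \<mu>) * Fin (real (L - (j - i)) * \<mu>)"
      using short[of v "j - i"] v by (intro trop_mult_mono) auto
    also have "\<dots> = Fin (real L * \<mu>)"
      using v 4 by (simp add: of_nat_diff algebra_simps)
    finally show ?thesis using eq by (simp add: mult_ac)
  qed (use less.prems short A in \<open>auto simp: max_weight_0\<close>)
qed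

lemma max_weight_mono:
  assumes A: "A \<in> carrier_mat n n" and B: "B \<in> carrier_mat n n"
    and le: "\<And>i j. i < n \<Longrightarrow> j < n \<Longrightarrow> B $$ (i, j) \<le> A $$ (i, j)" and xy: "x < n" "y < n"
  shows "max_weight B p x y \<le> max_weight A p x y"
proof (cases "max_weight B p x y = 0")
  case False
  from max_weight_attained[OF B xy False] obtain f where
    f: "f 0 = x" "f p = y" "\<forall>k\<le>p. f k < n"
    "max_weight B p x y = (\<Prod>k = 0..<p. B $$ (f k, f (Suc k)))"
    by blast
  have "(\<Prod>k = 0..<p. B $$ (f k, f (Suc k))) \<le> (\<Prod>k = 0..<p. A $$ (f k, f (Suc k)))"
    using f by (intro trop_prod_mono le) auto
  also have "\<dots> \<le> max_weight A p x y"
    using prod_le_max_weight[OF A, of 0 p f] f by simp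
  finally show ?thesis using f by simp
qed simp

text \<open>
  Apply the bound for closed walks to the matrix obtained from \<open>A\<close> by deleting the edges that
  leave vertices outside \<open>S\<close>; no optimal closed walk at \<open>u\<close> is lost.
\<close>

lemma max_weight_closed_le_on:
  assumes A: "A \<in> carrier_mat n n" and u: "u < n"
    and short: "\<And>v e. v \<in> S \<Longrightarrow> v < n \<Longrightarrow> 1 \<le> e \<Longrightarrow> e \<le> n \<Longrightarrow> max_weight A e v v \<le> Fin (real e * \<mu>)"
    and S: "\<And>w i. w < n \<Longrightarrow> i \<le> L \<Longrightarrow>
      max_weight A i u w * max_weight A (L - i) w u = max_weight A L u u \<Longrightarrow> w \<in> S"
  shows "max_weight A L u u \<le> Fin (real L * \<mu>)"
proof (cases "max_weight A L u u = 0")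
  case False
  define B where "B = mat n n (\<lambda>(i, j). if i \<in> S then A $$ (i, j) else 0)"
  have B: "B \<in> carrier_mat n n" by (simp add: B_def)
  have "max_weight B e v v \<le> Fin (real e * \<mu>)" if e: "v < n" "1 \<le> e" "e \<le> n" for v e
  proof (cases "v \<in> S")
    case True
    have "max_weight B e v v \<le> max_weight A e v v"
      using e by (intro max_weight_mono[OF A B]) (auto simp: B_def)
    then show ?thesis using short[OF True e] by (rule order_trans)
  next
    case False
    \<comment> \<open>Row \<open>v\<close> of \<open>B\<close> is \<open>0\<close>, so no walk of
      positive length leaves \<open>v\<close>.\<close>
    have "max_weight B e v v = 0"
    proof (rule ccontr)
      assume nz: "max_weight B e v v \<noteq> 0"
      from max_weight_attained[OF B e(1,1) nz] obtain f where
        f: "f 0 = v" "\<forall>k\<le>e. f k < n" "max_weight B e v v = (\<Prod>k = 0..<e. B $$ (f k, f (Suc k)))"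
        by blast
      have "B $$ (f 0, f (Suc 0)) = 0"
        using f(2) e False by (simp add: B_def f(1))
      then have "(\<Prod>k = 0..<e. B $$ (f k, f (Suc k))) = 0"
        using e by (intro prod_zero) auto
      with f nz show False by simp
    qed
    then show ?thesis by simp
  qed
  then have *: "max_weight B L u u \<le> Fin (real L * \<mu>)"
    by (rule max_weight_closed_le[OF B]) (use u in auto)
  obtain f where f: "f 0 = u" "f L = u" "\<And>k. k \<le> L \<Longrightarrow> f k < n"
    and prod: "max_weight A L u u = (\<Prod>k = 0..<L. A $$ (f k, f (Suc k)))"
    and split: "\<And>i j. i \<le> j \<Longrightarrow> j \<le> L \<Longrightarrow> max_weight A L u u =
      max_weight A i u (f i) * max_weight A (j - i) (f i) (f j) * max_weight A (L - j) (f j) u"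
    by (rule max_weight_attained_split[OF A u u False]) blast
  \<comment> \<open>Splitting with an empty middle piece puts each vertex of the optimal closed walk
    into \<open>S\<close>, so \<open>B\<close> retains all edges of this walk.\<close>
  have "f i \<in> S" if "i \<le> L" for i
    using split[of i i] that f by (intro S[of _ i]) (auto simp: max_weight_0[OF A] Fin_0_eq_1)
  then have "max_weight A L u u = (\<Prod>k = 0..<L. B $$ (f k, f (Suc k)))"
    unfolding prod using f(3) by (intro prod.cong) (auto simp: B_def)
  also have "\<dots> \<le> max_weight B L u u"
    using prod_le_max_weight[OF B, of 0 L f] f by simp
  finally show ?thesis using * by (rule order_trans)
qed simp

subsection \<open>Optimal walks waiting at a vertex\<close>

locale loop_weights =
  fixes A :: "trop mat" and n N :: nat and d :: "nat \<Rightarrow> real"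
  assumes A: "A \<in> carrier_mat n n"
    and N_pos: "N > 0"
    and dvd_N: "\<And>e. 1 \<le> e \<Longrightarrow> e \<le> n \<Longrightarrow> e dvd N"
    and loop: "\<And>v. v < n \<Longrightarrow> max_weight A N v v = Fin (d v)"
begin

abbreviation "W \<equiv> max_weight A"

lemma W_mult_le: "x < n \<Longrightarrow> z < n \<Longrightarrow> y < n \<Longrightarrow> p + q = r \<Longrightarrow> W p x z * W q z y \<le> W r x y"
  using max_weight_mult_le[OF A] by blast

lemma Fin_le_W_loop: "v < n \<Longrightarrow> Fin (real m * d v) \<le> W (m * N) v v"
  by (rule max_weight_loop[OF A]) (simp_all add: loop)

text \<open>Here divisibility enters: a closed walk of length \<open>e\<close> repeated
  \<open>N / e\<close> times is a closed walk of length \<open>N\<close> at \<open>v\<close>, of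
  weight at most \<open>d v\<close>.\<close>

lemma W_short_le:
  assumes v: "v < n" "d v \<le> \<delta>" and e: "1 \<le> e" "e \<le> n"
  shows "W e v v \<le> Fin (real e * (\<delta> / real N))"
proof (cases "W e v v")
  case (Fin r)
  obtain k where k: "N = k * e" using dvd_N[OF e] by (auto simp: dvd_def mult.commute)
  have "Fin (real k * r) \<le> W (k * e) v v" by (rule max_weight_loop[OF A v(1)]) (simp add: Fin)
  then have "real k * r \<le> \<delta>" using loop[OF v(1)] v(2) k by simp
  moreover have "k > 0" using N_pos k by simp
  ultimately show ?thesis using k e Fin by (simp add: field_simps)
qed simp

end

locale optimal_walks = loop_weights +
  fixes x y t :: nat
  assumes xy: "x < n" "y < n" and opt_nz: "max_weight A (t * N) x y \<noteq> 0"
begin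

abbreviation "opt \<equiv> W (t * N) x y"

text \<open>The reverse of \<open>opt \<le> ...\<close> holds by concatenation, so these are the
  vertices on optimal walks. The time \<open>p\<close> is arbitrary, not only a multiple of
  \<open>N\<close>.\<close>

definition visited :: "nat set" where
  "visited = {v. v < n \<and> (\<exists>p q. p + q = t * N \<and> opt \<le> W p x v * W q v y)}"

definition \<delta> :: real where
  "\<delta> = Max (d ` visited)"

lemma finite_visited: "finite visited"
  by (simp add: visited_def)

lemma x_visited: "x \<in> visited"
proof -
  have "opt \<le> W 0 x x * opt"
    using xy by (simp add: max_weight_0[OF A] Fin_0_eq_1)
  then show ?thesis unfolding visited_def using xy by force
qed

lemma d_le: "v \<in> visited \<Longrightarrow> d v \<le> \<delta>"
  unfolding \<delta>_def using finite_visited by (intro Max_ge) auto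

lemma d_attained: "\<exists>v\<in>visited. d v = \<delta>"
  unfolding \<delta>_def using Max_in[of "d ` visited"] finite_visited x_visited by fastforce

lemma visitedI:
  "v < n \<Longrightarrow> p + q = t * N \<Longrightarrow> opt \<le> W p x v * W q v y \<Longrightarrow> v \<in> visited"
  unfolding visited_def by blast

text \<open>All vertices of a closed piece of an optimal walk are in \<open>visited\<close>, so by
  \<open>W_short_le\<close> the short closed walks at them have mean at most
  \<open>\<delta> / N\<close>; \<open>max_weight_closed_le_on\<close> extends this to the
  piece.\<close>

lemma closed_le:
  assumes u: "u < n" and pq: "p + k * N + q = t * N"
    and opt: "opt \<le> W p x u * W (k * N) u u * W q u y"
  shows "W (k * N) u u \<le> Fin (real k * \<delta>)"
proof -
  have "W (k * N) u u \<le> Fin (real (k * N) * (\<delta> / real N))"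
  proof (rule max_weight_closed_le_on[OF A u, of visited])
    fix w i assume w: "w < n" and i: "i \<le> k * N"
      and eq: "W i u w * W (k * N - i) w u = W (k * N) u u"
    have "opt \<le> (W p x u * W i u w) * (W (k * N - i) w u * W q u y)"
      using opt unfolding eq[symmetric] by (simp add: mult_ac)
    also have "\<dots> \<le> W (p + i) x w * W (k * N - i + q) w y"
      using u w xy by (intro trop_mult_mono W_mult_le) auto
    finally show "w \<in> visited"
      using i pq by (intro visitedI[OF w, of "p + i" "k * N - i + q"]) auto
  qed (use d_le W_short_le in auto)
  then show ?thesis using N_pos by simp
qed

text \<open>A long segment of an optimal walk repeats a vertex at two multiples of \<open>N\<close>.
  The closed piece in between is cut out, and by \<open>closed_le\<close> the value
  \<open>k * \<delta>\<close> pays for it.\<close>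

lemma shorten:
  assumes sz: "s < n" "z < n" and len: "a + p + b = t * N" and p: "n * N \<le> p"
    and opt: "opt \<le> W a x s * W p s z * W b z y"
  shows "\<exists>k\<ge>1. k * N \<le> p \<and> W p s z \<le> Fin (real k * \<delta>) * W (p - k * N) s z"
proof -
  have nz: "W p s z \<noteq> 0" using opt opt_nz by auto
  obtain u i j where u: "u < n" "i < j" "j \<le> n" and eq: "W p s z =
    W (i * N) s u * W ((j - i) * N) u u * W (p - j * N) u z"
    by (rule max_weight_pigeonhole[OF A sz nz p]) blast
  have jN: "j * N \<le> p" using u(3) p by (meson le_trans mult_le_mono1)
  have ij: "i * N + (j - i) * N = j * N"
    using u(2) by (simp add: diff_mult_distrib)
  have "opt \<le> (W a x s * W (i * N) s u) * W ((j - i) * N) u u * (W (p - j * N) u z * W b z y)"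
    using opt unfolding eq by (simp add: mult_ac)
  also have "\<dots> \<le> W (a + i * N) x u * W ((j - i) * N) u u * W (p - j * N + b) u y"
    using u sz xy by (intro trop_mult_mono W_mult_le order_refl) auto
  finally have "W ((j - i) * N) u u \<le> Fin (real (j - i) * \<delta>)"
    using len jN ij by (intro closed_le[OF u(1), of "a + i * N" _ "p - j * N + b"]) auto
  then have "W p s z \<le> W (i * N) s u * Fin (real (j - i) * \<delta>) * W (p - j * N) u z"
    unfolding eq by (intro trop_mult_mono) auto
  also have "\<dots> = Fin (real (j - i) * \<delta>) * (W (i * N) s u * W (p - j * N) u z)"
    by (simp add: mult_ac)
  also have "\<dots> \<le> Fin (real (j - i) * \<delta>) * W (p - (j - i) * N) s z"
    using u sz ij jN by (intro trop_mult_mono W_mult_le) auto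
  finally show ?thesis using u ij jN by (intro exI[of _ "j - i"]) auto
qed

text \<open>The \<open>m\<close> loops are credited with \<open>\<delta>\<close> each; they are
  realised by walks only if \<open>d z = \<delta>\<close>. For \<open>m = 0\<close> the middle
  factor is the unit, and \<open>z\<close> is merely visited at time \<open>p\<close>.\<close>

definition waiting :: "nat \<Rightarrow> nat \<Rightarrow> nat \<Rightarrow> nat \<Rightarrow> bool" where
  "waiting z p m q \<longleftrightarrow> p + m * N + q = t * N \<and> opt \<le> W p x z * Fin (real m * \<delta>) * W q z y"

text \<open>The loops are merged into one outer part, so that \<open>shorten\<close> can be applied
  to the other.\<close>

lemma waiting_visited:
  assumes z: "z < n" "d z = \<delta>" and w: "waiting z p m q"
  shows "opt \<le> W p x z * W (m * N + q) z y" "opt \<le> W (p + m * N) x z * W q z y"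
proof -
  have "opt \<le> W p x z * Fin (real m * \<delta>) * W q z y"
    using w by (simp add: waiting_def)
  also have "\<dots> \<le> W p x z * W (m * N) z z * W q z y"
    using Fin_le_W_loop[of z m] z by (intro trop_mult_mono) auto
  finally have *: "opt \<le> W p x z * W (m * N) z z * W q z y" .
  also have "\<dots> = W p x z * (W (m * N) z z * W q z y)"
    by (simp add: mult_ac)
  also have "\<dots> \<le> W p x z * W (m * N + q) z y"
    using z xy by (intro trop_mult_mono W_mult_le) auto
  finally show "opt \<le> W p x z * W (m * N + q) z y" .
  note *
  also have "W p x z * W (m * N) z z * W q z y \<le> W (p + m * N) x z * W q z y"
    using z xy by (intro trop_mult_mono W_mult_le) auto
  finally show "opt \<le> W (p + m * N) x z * W q z y" .
qed

text \<open>As long as an outer part has length at least \<open>n * N\<close>,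
  \<open>shorten\<close> turns a positive multiple of \<open>N\<close> of its steps into loops at
  \<open>z\<close>. This decreases \<open>p + q\<close> and keeps the residues modulo
  \<open>N\<close>.\<close>

lemma waiting_reduce:
  assumes z: "z < n" "d z = \<delta>"
  shows "waiting z p m q \<Longrightarrow> \<exists>p' m' q'. waiting z p' m' q' \<and> p' < n * N \<and> q' < n * N \<and>
    p' mod N = p mod N \<and> q' mod N = q mod N"
proof (induction "p + q" arbitrary: p m q rule: less_induct)
  case less
  note w = \<open>waiting z p m q\<close>
  have len: "p + m * N + q = t * N" and opt: "opt \<le> W p x z * Fin (real m * \<delta>) * W q z y"
    using w by (auto simp: waiting_def)
  have step: "waiting z (p - k * N) (m + k) q"
    if "k * N \<le> p" "W p x z \<le> Fin (real k * \<delta>) * W (p - k * N) x z" for k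
  proof -
    have "opt \<le> (Fin (real k * \<delta>) * W (p - k * N) x z) * Fin (real m * \<delta>) * W q z y"
      using opt that(2) by (meson order_refl order_trans trop_mult_mono)
    also have "\<dots> = W (p - k * N) x z * (Fin (real k * \<delta>) * Fin (real m * \<delta>)) * W q z y"
      by (simp only: mult_ac)
    finally show ?thesis using that(1) len by (simp add: waiting_def algebra_simps)
  qed
  have step': "waiting z p (m + k) (q - k * N)"
    if "k * N \<le> q" "W q z y \<le> Fin (real k * \<delta>) * W (q - k * N) z y" for k
  proof -
    have "opt \<le> W p x z * Fin (real m * \<delta>) * (Fin (real k * \<delta>) * W (q - k * N) z y)"
      using opt that(2) by (meson order_refl order_trans trop_mult_mono)
    also have "\<dots> = W p x z * (Fin (real k * \<delta>) * Fin (real m * \<delta>)) * W (q - k * N) z y"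
      by (simp only: mult_ac)
    finally show ?thesis using that(1) len by (simp add: waiting_def algebra_simps)
  qed
  have mod: "(r - k * N) mod N = r mod N" if "k * N \<le> r" for r k
    using that by (metis le_add_diff_inverse2 mod_mult_self1)
  have id: "W 0 v v = 1" if "v < n" for v
    using that by (simp add: max_weight_0[OF A] one_trop_def)
  consider "n * N \<le> p" | "n * N \<le> q" | "p < n * N" "q < n * N" by linarith
  then show ?case
  proof cases
    case 1
    then obtain k where k: "k \<ge> 1" "k * N \<le> p" "W p x z \<le> Fin (real k * \<delta>) * W (p - k * N) x z"
      using shorten[of x z 0 p "m * N + q"] z xy len waiting_visited(1)[OF z w] by (auto simp: id)
    have "k * N > 0" using k N_pos by simp
    then have "p - k * N + q < p + q" using k by linarith
    from less.hyps[OF this step[OF k(2,3)]] mod[OF k(2)] show ?thesis by auto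
  next
    case 2
    then obtain k where k: "k \<ge> 1" "k * N \<le> q" "W q z y \<le> Fin (real k * \<delta>) * W (q - k * N) z y"
      using shorten[of z y "p + m * N" q 0] z xy len waiting_visited(2)[OF z w] by (auto simp: id)
    have "k * N > 0" using k N_pos by simp
    then have "p + (q - k * N) < p + q" using k by linarith
    from less.hyps[OF this step'[OF k(2,3)]] mod[OF k(2)] show ?thesis by auto
  next
    case 3
    with w show ?thesis by blast
  qed
qed

text \<open>
  A vertex \<open>z\<close> with the best loop may be visited at a time that is not a multiple of \<open>N\<close>. Once an
  optimal walk runs through the best closed walk of length \<open>N\<close> at \<open>z\<close>, however, the vertex \<open>z'\<close>
  occupied at the next multiple of \<open>N\<close> has a loop that is just as good.
\<close>

lemma ex_waiting:
  assumes t: "t \<ge> 2 * n"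
  shows "\<exists>z p m q. z < n \<and> p < n \<and> q < n \<and> p + m + q = t \<and>
    opt \<le> W (p * N) x z * Fin (real m * d z) * W (q * N) z y"
proof -
  obtain z where "z \<in> visited" and dz: "d z = \<delta>" using d_attained by blast
  then obtain p q where z: "z < n" and "p + q = t * N" "opt \<le> W p x z * W q z y"
    unfolding visited_def by auto
  then have "waiting z p 0 q" by (simp add: waiting_def flip: one_trop_def)
  then obtain p m q where w: "waiting z p m q" and pq: "p < n * N" "q < n * N"
    using waiting_reduce[OF z dz] by blast
  have len: "p + m * N + q = t * N" and opt: "opt \<le> W p x z * Fin (real m * \<delta>) * W q z y"
    using w by (auto simp: waiting_def)
  \<comment> \<open>Both outer parts are shorter than \<open>n * N\<close>, so at least one loop
    remains.\<close>
  have "2 * n * N \<le> t * N" using t by (rule mult_le_mono1)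
  then have "n * N + n * N \<le> t * N" by (simp add: mult_2 add_mult_distrib)
  then have "p + q < t * N" using pq by (meson add_strict_mono order_less_le_trans)
  then have "m \<noteq> 0" using len by (intro notI) (simp only: mult_0 add_0_right less_irrefl)
  then obtain m' where m': "m = Suc m'" using not0_implies_Suc by blast
  \<comment> \<open>\<open>s\<close> is the number of steps from time \<open>p\<close> to the next
    multiple of \<open>N\<close>.\<close>
  define s where "s = (N - p mod N) mod N"
  have s: "s < N" using N_pos by (simp add: s_def)
  have ps: "N dvd p + s"
  proof (cases "p mod N = 0")
    case False
    have "p mod N < N" using N_pos by simp
    then have "p mod N + s = N" using False by (simp add: s_def)
    then have "(p + s) mod N = 0" by (metis mod_add_left_eq mod_self)
    then show ?thesis by (simp add: dvd_eq_mod_eq_0)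
  qed (simp add: s_def dvd_eq_mod_eq_0)
  \<comment> \<open>The first of the loops at \<open>z\<close> is realised by an optimal closed
    walk, which is at \<open>z'\<close> after \<open>s\<close> steps.\<close>
  obtain z' where z': "z' < n" and zz': "W N z z = W s z z' * W (N - s) z' z"
    using max_weight_split[OF A z z, of s "N - s"] loop[OF z] s by auto
  have "opt \<le> W p x z * W m z z * W q z y \<Longrightarrow> True" by simp
  have "Fin (real m * \<delta>) = W N z z * Fin (real m' * d z)"
    using loop[OF z] dz m' by (simp add: algebra_simps)
  also have "\<dots> \<le> W s z z' * (W (N - s) z' z * W (m' * N) z z)"
    unfolding zz' using Fin_le_W_loop[OF z, of m'] by (simp add: mult.assoc trop_mult_mono)
  also have "\<dots> \<le> W s z z' * W (m * N - s) z' z"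
    using z z' s m' by (intro trop_mult_mono W_mult_le) auto
  finally have "W p x z * Fin (real m * \<delta>) * W q z y \<le>
      W p x z * (W s z z' * W (m * N - s) z' z) * W q z y"
    by (intro trop_mult_mono) auto
  also have "\<dots> = (W p x z * W s z z') * (W (m * N - s) z' z * W q z y)"
    by (simp add: mult_ac)
  also have "\<dots> \<le> W (p + s) x z' * W (m * N - s + q) z' y"
    using z z' xy by (intro trop_mult_mono W_mult_le) auto
  finally have opt': "opt \<le> W (p + s) x z' * W (m * N - s + q) z' y"
    using opt by (rule order_trans[rotated])
  have len': "p + s + (m * N - s + q) = t * N"
    using len s m' by simp
  have "d z' \<le> \<delta>" using d_le[OF visitedI[OF z' len' opt']] .
  \<comment> \<open>The same closed walk, started at \<open>z'\<close> instead.\<close>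
  moreover have "W N z z \<le> W N z' z'"
    unfolding zz' using W_mult_le[OF z' z z', of "N - s" s N] s by (simp add: mult.commute)
  ultimately have dz': "d z' = \<delta>" using loop z z' dz by auto
  have "waiting z' (p + s) 0 (m * N - s + q)"
    using opt' len' by (simp add: waiting_def flip: one_trop_def)
  \<comment> \<open>The total \<open>t * N\<close> and the first part \<open>p + s\<close> are
    multiples of \<open>N\<close>. As \<open>waiting_reduce\<close> keeps residues, both outer parts
    stay multiples of \<open>N\<close>.\<close>
  moreover have "N dvd m * N - s + q"
    using dvd_add_right_iff[OF ps, of "m * N - s + q"] unfolding len' by simp
  ultimately obtain p' k q' where w': "waiting z' p' k q'" and
    "p' < n * N" "q' < n * N" "N dvd p'" "N dvd q'"
    using waiting_reduce[OF z' dz', of "p + s" 0 "m * N - s + q"] ps by (auto simp: dvd_eq_mod_eq_0)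
  then obtain a b where ab: "p' = a * N" "q' = b * N" "a < n" "b < n"
    by (auto simp: dvd_def mult.commute)
  have "(a + k + b) * N = t * N" using w' ab by (simp add: waiting_def algebra_simps)
  then have "a + k + b = t" using N_pos by simp
  moreover have "opt \<le> W (a * N) x z' * Fin (real k * d z') * W (b * N) z' y"
    using w' unfolding waiting_def ab dz' by (rule conjunct2)
  ultimately show ?thesis
    using z' ab by (intro exI[of _ z'] exI[of _ a] exI[of _ k] exI[of _ b] conjI)
qed

end

section \<open>Leaving out a vertex by means of a heavy cycle\<close>

context loop_weights
begin

text \<open>
  An optimal walk that waits at \<open>k\<close> at time \<open>n * N\<close> can be rerouted along the cycle through \<open>j\<close>,
  which it enters one step earlier. So the \<open>n * N\<close>-th step never has to be at \<open>k\<close>.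
\<close>

lemma factor_rank_less_if_cycle:
  assumes kj: "k < n" "j < n" "j \<noteq> k" and l: "2 \<le> l" "l \<le> n"
    and cycle: "Fin (real l * d k) \<le> W N k j * W ((l - 1) * N) j k"
    and t: "t \<ge> 3 * n - 2"
  shows "factor_rank (A ^\<^sub>m (t * N)) < n"
proof (rule factor_rank_less[OF _ kj(1)])
  show "A ^\<^sub>m (t * N) \<in> carrier_mat n n" using A by simp
  fix x y assume xy: "x < n" "y < n"
  \<comment> \<open>The best weight of a walk that is at \<open>j\<close> after \<open>n * N\<close>
    steps.\<close>
  let ?f = "\<lambda>j. W (n * N) x j * W ((t - n) * N) j y"
  have tn: "n + (t - n) = t" using t l by simp
  have nN: "n * N + (t - n) * N = t * N" using tn by (metis add_mult_distrib)
  have "W (t * N) x y \<le> sum ?f ({0..<n} - {k})"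
  proof (cases "W (t * N) x y = 0")
    case False
    then interpret optimal_walks A n N d x y t
      using xy by unfold_locales auto
    have "t \<ge> 2 * n" using t l by simp
    then obtain z p m q where z: "z < n" and pq: "p < n" "q < n" "p + m + q = t" and
      opt: "opt \<le> W (p * N) x z * Fin (real m * d z) * W (q * N) z y"
      using ex_waiting by blast
    show ?thesis
    proof (cases "z = k")
      case False
      \<comment> \<open>The walk reaches \<open>z\<close> at time \<open>p * N\<close>, and
        \<open>m1\<close> loops last exactly until time \<open>n * N\<close>; the bound on
        \<open>t\<close> gives \<open>m1 \<le> m\<close>.\<close>
      define m1 where "m1 = n - p"
      define m2 where "m2 = m - m1"
      have m: "p + m1 = n" "m = m1 + m2" "m2 + q = t - n"
        using pq t l by (auto simp: m1_def m2_def)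
      note opt
      also have "W (p * N) x z * Fin (real m * d z) * W (q * N) z y =
          (W (p * N) x z * Fin (real m1 * d z)) * (Fin (real m2 * d z) * W (q * N) z y)"
      proof -
        have "Fin (real m * d z) = Fin (real m1 * d z) * Fin (real m2 * d z)"
          using m(2) by (simp add: distrib_right)
        then show ?thesis by (simp only: mult.assoc)
      qed
      also have "\<dots> \<le> (W (p * N) x z * W (m1 * N) z z) * (W (m2 * N) z z * W (q * N) z y)"
        using Fin_le_W_loop[OF z] by (intro trop_mult_mono) auto
      also have "\<dots> \<le> ?f z"
        using z xy m(1,3) by (intro trop_mult_mono W_mult_le) (auto simp only: add_mult_distrib[symmetric])
      also have "\<dots> \<le> sum ?f ({0..<n} - {k})"
        using z False by (intro trop_le_sum) auto
      finally show ?thesis .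
    next
      case True
      \<comment> \<open>Waiting stops one loop early, so that the step from \<open>k\<close> to
        \<open>j\<close> ends at time \<open>n * N\<close>. Since \<open>q \<le> n - 1\<close> and
        \<open>l \<le> n\<close>, the bound \<open>3 * n - 2\<close> on \<open>t\<close> is just
        enough for \<open>m1 + l \<le> m\<close>.\<close>
      define m1 where "m1 = n - 1 - p"
      define m2 where "m2 = m - m1 - l"
      have m: "p + m1 + 1 = n" "m = m1 + l + m2" "(l - 1) + m2 + q = t - n"
        using pq t l by (auto simp: m1_def m2_def)
      have "Fin (real m * d k) = Fin (real m1 * d k) * Fin (real l * d k) * Fin (real m2 * d k)"
        using m(2) by (simp add: distrib_right)
      also have "\<dots> \<le> W (m1 * N) k k * (W N k j * W ((l - 1) * N) j k) * W (m2 * N) k k"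
        using Fin_le_W_loop[OF kj(1)] cycle by (intro trop_mult_mono)
      finally have "opt \<le> W (p * N) x k * (W (m1 * N) k k * (W N k j * W ((l - 1) * N) j k) *
          W (m2 * N) k k) * W (q * N) k y"
        using opt True by (meson order_refl order_trans trop_mult_mono)
      also have "\<dots> = (W (p * N) x k * W (m1 * N) k k * W N k j) *
          (W ((l - 1) * N) j k * W (m2 * N) k k * W (q * N) k y)"
        by (simp only: mult_ac)
      also have "\<dots> \<le> (W (p * N + m1 * N) x k * W N k j) *
          (W ((l - 1) * N + m2 * N) j k * W (q * N) k y)"
        using kj xy by (intro trop_mult_mono W_mult_le order_refl) auto
      also have "\<dots> \<le> ?f j"
      proof (intro trop_mult_mono W_mult_le)
        show "p * N + m1 * N + N = n * N"
          unfolding m(1)[symmetric] by (simp add: add_mult_distrib)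
        show "(l - 1) * N + m2 * N + q * N = (t - n) * N"
          unfolding m(3)[symmetric] by (simp only: add_mult_distrib)
      qed (use kj xy in auto)
      also have "\<dots> \<le> sum ?f ({0..<n} - {k})"
        using kj by (intro trop_le_sum) auto
      finally show ?thesis .
    qed
  qed simp
  moreover have "sum ?f ({0..<n} - {k}) \<le> W (t * N) x y"
    using xy nN by (auto simp: trop_sum_le_iff intro!: W_mult_le)
  ultimately show "(A ^\<^sub>m (t * N)) $$ (x, y) = sum ?f ({0..<n} - {k})"
    by (simp add: max_weight_def)
qed

end

section \<open>Vertices on no cycle\<close>

lemma factor_rank_less_if_no_loop:
  assumes A: "A \<in> carrier_mat n n" and i: "i < n" and N: "max_weight A N i i = 0"
    and dvd_N: "\<And>e. 1 \<le> e \<Longrightarrow> e \<le> n \<Longrightarrow> e dvd N" and L: "L \<ge> 1"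
  shows "factor_rank (A ^\<^sub>m L) < n"
proof -
  let ?W = "max_weight A"
  \<comment> \<open>A closed walk at \<open>i\<close> with \<open>s \<le> n\<close> steps could be
    repeated to length \<open>N\<close>. A longer one loses a closed piece of at most
    \<open>n < s\<close> steps and remains a closed walk of positive length at
    \<open>i\<close>.\<close>
  have acyclic: "s \<ge> 1 \<Longrightarrow> ?W s i i = 0" for s
  proof (induction s rule: less_induct)
    case (less s)
    show ?case
    proof (rule ccontr)
      assume nz: "?W s i i \<noteq> 0"
      show False
      proof (cases "s \<le> n")
        case True
        obtain r where r: "?W s i i = Fin r" using nz by (rule trop_neq_zeroE)
        obtain k where "N = k * s" using dvd_N[of s] less.prems True by (auto simp: dvd_def mult.commute)
        with max_weight_loop[OF A i, of r s k] r N show False by simp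
      next
        case False
        then have "n * 1 \<le> s" by simp
        then obtain u a b where u: "u < n" "a < b" "b \<le> n" and eq: "?W s i i =
            ?W (a * 1) i u * ?W ((b - a) * 1) u u * ?W (s - b * 1) u i"
          by (rule max_weight_pigeonhole[OF A i i nz]) blast
        have "?W (a + (s - b)) i i = 0"
          using u False by (intro less.IH) auto
        with max_weight_mult_le[OF A i u(1) i, of a "s - b"] eq nz show False by auto
      qed
    qed
  qed
  define R where "R = {j. j < n \<and> (\<exists>s\<ge>1. ?W s i j \<noteq> 0)}"
  have iR: "i \<notin> R" using acyclic by (auto simp: R_def)
  have closed: "y \<in> R" if x: "x = i \<or> x \<in> R" and y: "y < n" and nz: "?W L x y \<noteq> 0" for x y
    using x
  proof
    assume "x \<in> R"
    then obtain s where s: "x < n" "s \<ge> 1" "?W s i x \<noteq> 0" by (auto simp: R_def)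
    then have "?W (s + L) i y \<noteq> 0"
      using max_weight_mult_le[OF A i s(1) y, of s L] nz by auto
    then show ?thesis using s y unfolding R_def by (auto intro!: exI[of _ "s + L"])
  qed (use y nz L in \<open>auto simp: R_def\<close>)
  \<comment> \<open>For \<open>j \<in> R\<close> the term is column \<open>j\<close> restricted to
    row \<open>i\<close> and the rows in \<open>R\<close>; for other \<open>j\<close> it is row
    \<open>j\<close>. By \<open>closed\<close>, the columns in \<open>R\<close> cover row
    \<open>i\<close>, so the index \<open>i\<close> can be omitted.\<close>
  define b where "b x j = (if j \<in> R then if x = i \<or> x \<in> R then ?W L x j else 0
    else if x = j then 1 else 0)" for x j
  define c where "c j y = (if j \<in> R then if y = j then 1 else 0 else ?W L j y)" for j y
  show ?thesis
  proof (rule factor_rank_less[OF _ i])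
    show "A ^\<^sub>m L \<in> carrier_mat n n" using A by simp
    fix x y assume xy: "x < n" "y < n"
    have "(\<Sum>j\<in>{0..<n} - {i}. b x j * c j y) = ?W L x y"
    proof (cases "x = i \<or> x \<in> R")
      case True
      have "(\<Sum>j\<in>{0..<n} - {i}. b x j * c j y) =
          (\<Sum>j\<in>{0..<n} - {i}. if j = y then ?W L x y else 0)"
        using True closed[OF True xy(2)] by (intro sum.cong) (auto simp: b_def c_def)
      then show ?thesis using closed[OF True xy(2)] iR xy by (auto simp: sum.delta)
    next
      case False
      have "(\<Sum>j\<in>{0..<n} - {i}. b x j * c j y) =
          (\<Sum>j\<in>{0..<n} - {i}. if j = x then ?W L x y else 0)"
        using False by (intro sum.cong) (auto simp: b_def c_def)
      then show ?thesis using False xy by (auto simp: sum.delta)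
    qed
    then show "(A ^\<^sub>m L) $$ (x, y) = (\<Sum>j\<in>{0..<n} - {i}. b x j * c j y)"
      by (simp add: max_weight_def)
  qed
qed

subsection \<open>A heavy cycle in a singular matrix\<close>

text \<open>The difference \<open>g - d\<close> vanishes at fixed points and has nonnegative sum, so
  its sum over some nontrivial cycle of \<open>p\<close> is nonnegative. On that cycle
  \<open>k\<close> minimises \<open>d\<close>, and \<open>l\<close> is its length.\<close>

lemma ex_heavy_cycle:
  fixes g d :: "nat \<Rightarrow> real"
  assumes p: "p permutes {0..<n}" "p \<noteq> id" and fix_eq: "\<And>i. p i = i \<Longrightarrow> g i = d i"
    and le: "(\<Sum>i = 0..<n. d i) \<le> (\<Sum>i = 0..<n. g i)"
  shows "\<exists>k l. k < n \<and> p k \<noteq> k \<and> 2 \<le> l \<and> l \<le> n \<and> (p ^^ l) k = k \<and>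
    real l * d k \<le> (\<Sum>s<l. g ((p ^^ s) k))"
proof -
  have perm: "permutation p" using p by (auto simp: permutation_permutes)
  define cyc where "cyc a = set (support p a)" for a
  define T where "T = {a. p a \<noteq> a}"
  have T: "T \<subseteq> {0..<n}" using p by (auto simp: T_def permutes_def)
  then have fin: "finite T" using finite_subset by blast
  have self: "a \<in> cyc a" for a
    using least_power_of_permutation(2)[OF perm, of a] by (force simp: cyc_def)
  have cyc_T: "\<Union> (cyc ` T) = T"
    using support_coverture[OF perm] unfolding T_def cyc_def image_Collect by blast
  have cyc_eq: "cyc b = cyc a" if "b \<in> cyc a" for a b
    using disjoint_support[OF perm] self[of b] that unfolding cyc_def disjoint_def by blast
  have "\<exists>a\<in>T. 0 \<le> (\<Sum>i\<in>cyc a. g i - d i)"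
  proof (rule ccontr)
    assume neg: "\<not> ?thesis"
    have "T \<noteq> {}" using p by (auto simp: T_def)
    have "(\<Sum>i = 0..<n. g i - d i) = (\<Sum>i\<in>T. g i - d i)"
      using T fix_eq by (intro sum.mono_neutral_right) (auto simp: T_def)
    also have "\<dots> = (\<Sum>C\<in>cyc ` T. \<Sum>i\<in>C. g i - d i)"
    proof -
      have "\<forall>C\<in>cyc ` T. finite C" by (simp add: cyc_def)
      moreover have "\<forall>C\<in>cyc ` T. \<forall>D\<in>cyc ` T. C \<noteq> D \<longrightarrow> C \<inter> D = {}"
        using cyc_eq by blast
      ultimately show ?thesis
        using sum.Union_disjoint[of "cyc ` T" "\<lambda>i. g i - d i"] by (simp add: cyc_T)
    qed
    also have "\<dots> < (\<Sum>C\<in>cyc ` T. 0)"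
      using fin \<open>T \<noteq> {}\<close> neg by (intro sum_strict_mono) auto
    finally show False using le by (simp add: sum_subtractf)
  qed
  then obtain a where a: "a \<in> T" "0 \<le> (\<Sum>i\<in>cyc a. g i - d i)" by blast
  have fin_a: "finite (cyc a)" by (simp add: cyc_def)
  then obtain k where k: "k \<in> cyc a" "\<And>i. i \<in> cyc a \<Longrightarrow> d k \<le> d i"
    using ex_min_if_finite[of "d ` cyc a"] self by (metis (no_types) arg_min_if_finite(1) arg_min_least empty_iff)
  have kT: "k \<in> T" using k a cyc_T by blast
  have cyc_k: "cyc a = cyc k" using cyc_eq k by blast
  define l where "l = least_power p k"
  have img: "cyc k = (\<lambda>s. (p ^^ s) k) ` {..<l}"
    by (auto simp: cyc_def l_def)
  have inj: "inj_on (\<lambda>s. (p ^^ s) k) {..<l}"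
    using cycle_of_permutation[OF perm, of k] by (simp add: distinct_map l_def atLeast0LessThan)
  have card: "card (cyc k) = l" unfolding img using card_image[OF inj] by simp
  have "cyc k \<subseteq> {0..<n}" using cyc_k a(1) cyc_T T by blast
  from card_mono[OF _ this] have "l \<le> n" by (simp add: card)
  moreover have "2 \<le> l"
    using least_power_gt_one[OF perm, of k] kT by (simp add: T_def l_def)
  moreover have "(p ^^ l) k = k"
    using least_power_of_permutation(1)[OF perm] by (simp add: l_def)
  moreover have "real l * d k \<le> (\<Sum>s<l. g ((p ^^ s) k))"
  proof -
    have "real l * d k = (\<Sum>i\<in>cyc k. d k)" by (simp add: card)
    also have "\<dots> \<le> (\<Sum>i\<in>cyc k. d i)" using k cyc_k by (intro sum_mono) auto
    also have "\<dots> \<le> (\<Sum>i\<in>cyc k. g i)" using a cyc_k by (simp add: sum_subtractf)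
    also have "\<dots> = (\<Sum>s<l. g ((p ^^ s) k))" unfolding img by (simp add: sum.reindex[OF inj])
    finally show ?thesis .
  qed
  moreover have "k < n" "p k \<noteq> k" using kT T by (auto simp: T_def)
  ultimately show ?thesis by (intro exI[of _ k] exI[of _ l] conjI)
qed

section \<open>From tropical rank to a permutation competing with the identity\<close>

lemma not_nonsingular_if_tropical_rank_less:
  assumes M: "M \<in> carrier_mat n n" and rank: "tropical_rank M < n"
  shows "\<not> trop_nonsingular M"
proof
  assume ns: "trop_nonsingular M"
  let ?I = "{0..<n}"
  let ?S = "{k. \<exists>I J. I \<subseteq> {0..<dim_row M} \<and> J \<subseteq> {0..<dim_col M} \<and>
     card I = k \<and> card J = k \<and> trop_nonsingular (submatrix M I J)}"
  \<comment> \<open>\<open>submatrix\<close> renumbers the chosen indices by counting smaller ones;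
    for the full index set this changes nothing.\<close>
  have less: "{a. a < n \<and> a < i} = {..<i}" if "i < n" for i using that by auto
  have "submatrix M ?I ?I = M"
  proof (rule eq_matI)
    fix i j assume ij: "i < dim_row M" "j < dim_col M"
    then have "card {a \<in> ?I. a < i} = i" "card {a \<in> ?I. a < j} = j"
      using M by (auto simp: less)
    then show "submatrix M ?I ?I $$ (i, j) = M $$ (i, j)"
      using submatrix_index_card[of i M j ?I ?I] ij M by auto
  qed (use M in \<open>auto simp: dim_submatrix\<close>)
  then have "n \<in> ?S" using M ns by (auto intro!: exI[of _ ?I])
  moreover have "?S \<subseteq> {..n}"
    using M card_mono[of ?I] by fastforce
  then have "finite ?S" using finite_subset by blast
  ultimately have "n \<le> tropical_rank M" unfolding tropical_rank_def by (rule Max_ge[rotated])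
  with rank show False by simp
qed

text \<open>Some permutation attains the permanent; if it is \<open>id\<close>, singularity provides
  a second one.\<close>

lemma ex_perm_weight_ge_diagonal:
  assumes M: "M \<in> carrier_mat n n" and sing: "\<not> trop_nonsingular M"
  shows "\<exists>p. p permutes {0..<n} \<and> p \<noteq> id \<and> perm_weight M id \<le> perm_weight M p"
proof -
  let ?P = "{p. p permutes {0..<n}}"
  have per: "trop_per M = Max (perm_weight M ` ?P)" using M by (simp add: trop_per_def)
  have fin: "finite (perm_weight M ` ?P)" by (simp add: finite_permutations)
  have id: "id \<in> ?P" by (simp add: permutes_id)
  then have "perm_weight M ` ?P \<noteq> {}" by blast
  then have "trop_per M \<in> perm_weight M ` ?P" unfolding per by (rule Max_in[OF fin])
  then obtain p where p: "p \<in> ?P" "perm_weight M p = trop_per M" by auto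
  obtain p' where p': "p' \<in> ?P" "perm_weight M p' = trop_per M" "p' \<noteq> id"
  proof (cases "p = id")
    case True
    with p sing M show ?thesis by (auto simp: trop_nonsingular_def intro: that)
  qed (use p that in blast)
  have "perm_weight M id \<le> trop_per M" unfolding per using fin id by (intro Max_ge) auto
  with p' show ?thesis by auto
qed

theorem proposition2p6:
  fixes n :: nat and A :: "trop mat"
  assumes "n \<ge> 1"
    and "A \<in> carrier_mat n n"
    and "tropical_rank (A ^\<^sub>m Lcm {1..n}) < n"
  shows "\<forall>t::nat. t \<ge> 3 * n - 2 \<longrightarrow> factor_rank (A ^\<^sub>m (t * Lcm {1..n})) < n"
proof (intro allI impI)
  fix t :: nat assume t: "t \<ge> 3 * n - 2"
  define N where "N = Lcm {1..n}"
  note A = assms(2)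
  have dvd_N: "e dvd N" if "1 \<le> e" "e \<le> n" for e using that by (simp add: N_def)
  have N_pos: "N > 0" unfolding N_def by (intro Nat.gr0I) (simp add: Lcm_0_iff)
  show "factor_rank (A ^\<^sub>m (t * Lcm {1..n})) < n"
  proof (cases "\<exists>i<n. max_weight A N i i = 0")
    case True
    then obtain i where "i < n" "max_weight A N i i = 0" by blast
    moreover have "t * N \<ge> 1" using t assms(1) N_pos by simp
    ultimately show ?thesis
      using factor_rank_less_if_no_loop[OF A _ _ dvd_N] by (simp add: N_def)
  next
    case False
    then have "\<forall>v. v < n \<longrightarrow> (\<exists>r. max_weight A N v v = Fin r)" by (metis trop_neq_zeroE)
    then obtain d where "\<And>v. v < n \<Longrightarrow> max_weight A N v v = Fin (d v)" by metis
    then interpret loop_weights A n N d using A N_pos dvd_N by unfold_locales auto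
    let ?M = "A ^\<^sub>m N"
    have M: "?M \<in> carrier_mat n n" using A by simp
    obtain p where p: "p permutes {0..<n}" "p \<noteq> id" and le: "perm_weight ?M id \<le> perm_weight ?M p"
      using ex_perm_weight_ge_diagonal[OF M not_nonsingular_if_tropical_rank_less[OF M]] assms(3)
      unfolding N_def by blast
    have weight: "perm_weight ?M q = (\<Prod>i = 0..<n. W N i (q i))" for q
      using A by (simp add: perm_weight_def max_weight_def)
    have diag: "perm_weight ?M id = Fin (\<Sum>i = 0..<n. d i)"
      unfolding weight trop_prod_Fin[symmetric] by (intro prod.cong) (auto simp: loop)
    have "perm_weight ?M p \<noteq> 0" using le diag by auto
    then have "W N i (p i) \<noteq> 0" if "i < n" for i
      unfolding weight using that by (meson atLeastLessThan_iff finite_atLeastLessThan prod_zero zero_le)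
    then have "\<forall>i. i < n \<longrightarrow> (\<exists>r. W N i (p i) = Fin r)" by (metis trop_neq_zeroE)
    then obtain g' where g': "\<And>i. i < n \<Longrightarrow> W N i (p i) = Fin (g' i)" by metis
    \<comment> \<open>\<open>p\<close> fixes every \<open>i \<ge> n\<close>, and
      \<open>ex_heavy_cycle\<close> asks for \<open>g i = d i\<close> at all fixed points; hence the
      default \<open>d i\<close>.\<close>
    define g where "g i = (if i < n then g' i else d i)" for i
    have g: "W N i (p i) = Fin (g i)" if "i < n" for i using g' that by (simp add: g_def)
    have "perm_weight ?M p = Fin (\<Sum>i = 0..<n. g i)"
      unfolding weight trop_prod_Fin[symmetric] by (intro prod.cong) (auto simp: g)
    with le diag have "(\<Sum>i = 0..<n. d i) \<le> (\<Sum>i = 0..<n. g i)" by simp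
    moreover have "g i = d i" if "p i = i" for i
      using that g[of i] loop[of i] by (cases "i < n") (auto simp: g_def)
    ultimately obtain k l where k: "k < n" "p k \<noteq> k" and l: "2 \<le> l" "l \<le> n"
      and cyc: "(p ^^ l) k = k" and heavy: "real l * d k \<le> (\<Sum>s<l. g ((p ^^ s) k))"
      using ex_heavy_cycle[OF p] by metis
    have p_less: "p i < n" if "i < n" for i using p that by (simp add: permutes_in_image[of p "{0..<n}", simplified])
    then have pow_less: "(p ^^ s) i < n" if "i < n" for i s using that by (induction s) auto
    have path: "Fin (\<Sum>s<r. g ((p ^^ s) i)) \<le> W (r * N) i ((p ^^ r) i)" if i: "i < n" for i r
    proof (induction r)
      case (Suc r)
      have "Fin (\<Sum>s<Suc r. g ((p ^^ s) i)) = Fin (\<Sum>s<r. g ((p ^^ s) i)) * Fin (g ((p ^^ r) i))"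
        by simp
      also have "\<dots> \<le> W (r * N) i ((p ^^ r) i) * W N ((p ^^ r) i) ((p ^^ Suc r) i)"
        using Suc g[OF pow_less[OF i]] by (intro trop_mult_mono) auto
      also have "\<dots> \<le> W (Suc r * N) i ((p ^^ Suc r) i)"
        by (rule W_mult_le[OF i pow_less[OF i] pow_less[OF i]]) simp
      finally show ?case .
    qed (use i in \<open>simp add: max_weight_0[OF A]\<close>)
    obtain r where r: "l = Suc r" using l by (cases l) auto
    have "Fin (real l * d k) \<le> Fin (\<Sum>s<Suc r. g ((p ^^ s) k))" using heavy r by simp
    \<comment> \<open>The first step of the cycle is split off; \<open>p k\<close> plays the part of
      \<open>j\<close> in \<open>factor_rank_less_if_cycle\<close>, and the other
      \<open>r = l - 1\<close> steps lead back to \<open>k\<close>.\<close>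
    also have "\<dots> = Fin (g k) * Fin (\<Sum>s<r. g ((p ^^ s) (p k)))"
      by (simp add: sum.lessThan_Suc_shift funpow_swap1 del: sum.lessThan_Suc)
    also have "\<dots> \<le> W N k (p k) * W ((l - 1) * N) (p k) k"
      using path[OF p_less[OF k(1)], of r] g[OF k(1)] cyc r
      by (intro trop_mult_mono) (auto simp: funpow_swap1)
    finally show ?thesis
      using factor_rank_less_if_cycle[OF k(1) p_less[OF k(1)] k(2) l _ t] by (simp add: N_def)
  qed
qed

end
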